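(* Let $s\geq 1$ be an integer, $\alpha\in\mathbb{R}$ and $\boldsymbol{x}=(x_1,\dots,x_n)\in\mathbb{R}^n$. Then $$S_{k;s}(\boldsymbol{x})^2\geq S_{k-1;s}(\boldsymbol{x})\,S_{k+1;s}(\boldsymbol{x}),\qquad k=s+1,\dots,n-1.$$ For each such $k$ the inequality is strict unless $x_1=x_2=\cdots=x_n$, or unless both sides of the inequality are $0$, or unless $$\frac{S_{k;s}(\boldsymbol{x})}{S_{k-1;s}(\boldsymbol{x})}=\frac{S_{k+1;s}(\boldsymbol{x})}{S_{k;s}(\boldsymbol{x})}=-\alpha.$$ Further, let $k\in\{2,3,\dots,n\}$. If $\alpha\geq 0$, $E_1(\boldsymbol{x})\geq 0$, $E_2(\boldsymbol{x})\geq 0$, $\dots$, $E_s(\boldsymbol{x})\geq 0$, and $S_{m;s}(\boldsymbol{x})\geq 0$ for all $m=s+1,s+2,\dots,k$, then $$S_{j;s}(\boldsymbol{x})^2\geq S_{j-1;s}(\boldsymbol{x})\,S_{j+1;s}(\boldsymbol{x})\qquad\text{for all } j=1,\dots,n-1,$$ and $$S_{1;s}(\boldsymbol{x})\geq S_{2;s}(\boldsymbol{x})^{1/2}\geq\cdots\geq S_{k;s}(\boldsymbol{x})^{1/k}.$$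
   Context: For $\boldsymbol{x}=(x_1,\dots,x_n)\in\mathbb{R}^n$, let $\sigma_k(\boldsymbol{x})=\sum_{1\leq i_1<\cdots<i_k\leq n}x_{i_1}\cdots x_{i_k}$ for $1\le k\le n$ be the $k$-th elementary symmetric function, and let $E_k(\boldsymbol{x})=\sigma_k(\boldsymbol{x})/\binom{n}{k}$ be its normalized mean. Conventions: $E_0(\boldsymbol{x})=1$, and $E_k(\boldsymbol{x})=0$ if $k<0$ or $k>n$. For $\alpha\in\mathbb{R}$ and an integer $s\ge 1$ define $$S_{k;s}(\boldsymbol{x})=\sum_{i=0}^{s}\binom{s}{i}\alpha^{i}E_{k-i}(\boldsymbol{x}).$$ *)

theory Defs
  imports "HOL-Analysis.Analysis"
begin

text \<open>The strictly increasing index tuples of length \<open>k\<close> are encoded as the \<open>k\<close>-element subsets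
  of the (finite) index type.\<close>

definition elem_symm :: "nat \<Rightarrow> real ^ 'n \<Rightarrow> real" where
  "elem_symm k x = (\<Sum>I | I \<subseteq> (UNIV :: 'n set) \<and> card I = k. \<Prod>i\<in>I. x $ i)"

text \<open>The index is an integer, since negative indices occur in \<open>S_mean\<close>. For \<open>k = 0\<close> the only
  subset is the empty one, so the value is \<open>1\<close>.\<close>

definition E_mean :: "int \<Rightarrow> real ^ 'n \<Rightarrow> real" where
  "E_mean k x =
    (if k < 0 \<or> k > int CARD('n) then 0
     else elem_symm (nat k) x / real (CARD('n) choose nat k))"

lemma E_mean_0: "E_mean 0 x = 1"
proof -
  have "{I. I \<subseteq> (UNIV :: 'a set) \<and> card I = 0} = {{}}"
    by auto
  then show ?thesis
    by (simp add: E_mean_def elem_symm_def del: card_0_eq)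
qed

definition S_mean :: "real \<Rightarrow> int \<Rightarrow> nat \<Rightarrow> real ^ 'n \<Rightarrow> real" where
  "S_mean \<alpha> k s x = (\<Sum>i=0..s. real (s choose i) * \<alpha> ^ i * E_mean (k - int i) x)"

end

theory Submission
  imports Defs "HOL-Computational_Algebra.Fundamental_Theorem_Algebra"
begin

text \<open>The numbers \<open>E_j\<close> are the binomially normalized coefficients of the real-rooted polynomial
  \<open>\<Prod>i. (1 + x_i z)\<close>. By Laguerre's theorem, real-rootedness of a binary form is preserved by
  directional derivatives, which act on normalized coefficients by
  \<open>a_j \<mapsto> p a_j + q a_(j+1)\<close>. Applying \<open>s\<close> derivatives in the direction \<open>(\<alpha>, 1)\<close> and further ones
  along the coordinate axes, one gets a real-rooted quadratic form with coefficients
  \<open>S_(k-1)\<close>, \<open>2 S_k\<close>, \<open>S_(k+1)\<close>; its discriminant is nonnegative.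

  If the discriminant vanishes, that quadratic form is a multiple of the square of a linear form
  \<open>L\<close>. A real-rooted form of degree at least \<open>3\<close> whose derivative in a direction \<open>w\<close> with
  \<open>L w \<noteq> 0\<close> is a nonzero multiple of a power of \<open>L\<close> is itself a multiple of a power of \<open>L\<close>:
  it can only differ from one by a multiple of a power of the linear form vanishing at \<open>w\<close>, and
  the sum of two such powers has nonreal zeros. Undoing all derivatives gives
  \<open>\<Prod>i. (1 + x_i z) = (1 + \<rho> z)^n\<close>; the exceptional directions are the degenerate cases.

  For \<open>j \<le> s\<close> the inequality holds because convolution with a binomial sequence preserves
  log-concavity without internal zeros, and the root inequalities follow by Maclaurin's
  induction. There, too, internal zeros are excluded by real-rootedness.\<close>

section \<open>Logarithmic derivatives and Laguerre's theorem\<close>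

lemma poly_pderiv_prod_mset:
  fixes z :: complex
  assumes "z \<notin># A"
  shows "poly (pderiv (\<Prod>r\<in>#A. [:-r, 1:])) z
    = poly (\<Prod>r\<in>#A. [:-r, 1:]) z * (\<Sum>r\<in>#A. 1 / (z - r))"
  using assms
proof (induction A)
  case (add r A)
  then have "z - r \<noteq> 0" by auto
  moreover have "pderiv (\<Prod>r\<in>#add_mset r A. [:-r, 1:])
    = [:-r, 1:] * pderiv (\<Prod>r\<in>#A. [:-r, 1:]) + (\<Prod>r\<in>#A. [:-r, 1:])"
    unfolding image_mset_add_mset prod_mset.add_mset pderiv_mult
    by (simp add: pderiv_pCons)
  moreover have "poly (pderiv (\<Prod>r\<in>#A. [:-r, 1:])) z
    = poly (\<Prod>r\<in>#A. [:-r, 1:]) z * (\<Sum>r\<in>#A. 1 / (z - r))"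
    using add by simp
  ultimately show ?case
    by (simp only: poly_add poly_mult image_mset_add_mset prod_mset.add_mset sum_mset.add_mset)
      (simp add: field_simps)
qed simp

text \<open>Per root, \<open>(q - p * z) / (z - r) + p = (q - p * r) / (z - r)\<close>. Multiplying
  by \<open>q - p * z\<close> makes the imaginary part a square times \<open>- Im z\<close>, so the
  terms cannot cancel each other.\<close>

lemma Im_polar_sum:
  fixes z :: complex and p q :: real
  assumes "Im z \<noteq> 0" "\<And>r. r \<in># A \<Longrightarrow> r \<in> \<real>"
  shows "Im ((q - p * z) * ((q - p * z) * (\<Sum>r\<in>#A. 1 / (z - r)) + p * size A))
    = - Im z * (\<Sum>r\<in>#A. (q - p * Re r)\<^sup>2 / (cmod (z - r))\<^sup>2)"
  using assms(2)
proof (induction A)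
  case (add r A)
  obtain t where r: "r = of_real t" using add.prems[of r] by (auto elim: Reals_cases)
  have nz: "z - r \<noteq> 0" using assms(1) r by auto
  have "(q - p * z) * ((q - p * z) * (1 / (z - r)) + p) = (q - p * z) * (q - p * t) / (z - t)"
    using nz by (simp add: r field_simps)
  also have "Im \<dots> = - Im z * ((q - p * t)\<^sup>2 / (cmod (z - r))\<^sup>2)"
  proof -
    have "Im ((q - p * z) * (q - p * t) / (z - t)) =
      (q - p * t) * (- p * Im z * (Re z - t) - (q - p * Re z) * Im z) / ((Re z - t)\<^sup>2 + (Im z)\<^sup>2)"
      by (simp add: Im_divide algebra_simps)
    also have "(- p * Im z * (Re z - t) - (q - p * Re z) * Im z) = - Im z * (q - p * t)"
      by (simp add: algebra_simps)
    finally show ?thesis by (simp add: r cmod_power2) (simp add: power2_eq_square mult_ac)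
  qed
  finally have 1: "Im ((q - p * z) * ((q - p * z) * (1 / (z - r)) + p))
    = - Im z * ((q - p * Re r)\<^sup>2 / (cmod (z - r))\<^sup>2)" by (simp add: r)
  have "(q - p * z) * ((q - p * z) * (\<Sum>r\<in>#add_mset r A. 1 / (z - r)) + p * size (add_mset r A))
    = (q - p * z) * ((q - p * z) * (1 / (z - r)) + p)
      + (q - p * z) * ((q - p * z) * (\<Sum>r\<in>#A. 1 / (z - r)) + p * size A)"
    by (simp add: algebra_simps)
  with 1 add show ?case by (simp add: algebra_simps)
qed simp

lemma sum_mset_eq_0_nonneg:
  fixes f :: "'a \<Rightarrow> real"
  assumes "(\<Sum>r\<in>#A. f r) = 0" "\<And>r. f r \<ge> 0" "r \<in># A"
  shows "f r = 0"
proof -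
  obtain B where "A = add_mset r B" using assms(3) by (metis insert_DiffM)
  moreover have "(\<Sum>r\<in>#B. f r) \<ge> 0" by (induction B) (use assms(2) in auto)
  ultimately show ?thesis using assms(1) assms(2)[of r] by auto
qed

text \<open>Laguerre's theorem. Away from the real axis, \<open>h / g\<close> is a sum of Moebius transforms of
  the variable which become, after multiplication by \<open>q - p z\<close>, numbers with imaginary parts
  of the same sign; they can only cancel if all of them vanish identically.\<close>

lemma laguerre:
  fixes g :: "complex poly" and p q :: real
  assumes g: "g \<noteq> 0" "degree g \<le> m" and roots: "\<And>z. poly g z = 0 \<Longrightarrow> z \<in> \<real>"
    and pq: "p \<noteq> 0 \<or> q \<noteq> 0"
    and h: "h = [:of_real q, - of_real p:] * pderiv g + smult (of_real (p * real m)) g"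
  shows "h = 0 \<or> (\<forall>z. poly h z = 0 \<longrightarrow> z \<in> \<real>)"
proof (rule disjCI)
  assume "\<not> (\<forall>z. poly h z = 0 \<longrightarrow> z \<in> \<real>)"
  then obtain z where z: "poly h z = 0" "Im z \<noteq> 0" by (auto simp: complex_is_Real_iff)
  obtain A where A: "size A = degree g" "g = smult (lead_coeff g) (\<Prod>x\<in>#A. [:-x, 1:])"
    using alg_closed_imp_factorization[OF g(1)] by auto
  have lc: "lead_coeff g \<noteq> 0" using g by simp
  have root_iff: "poly g w = 0 \<longleftrightarrow> w \<in># A" for w
  proof -
    have "poly (\<Prod>x\<in>#A. [:-x, 1:]) w = 0 \<longleftrightarrow> w \<in># A"
      by (induction A) auto
    then show ?thesis using lc A(2) by (metis mult_eq_0_iff poly_smult)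
  qed
  have Areal: "r \<in> \<real>" if "r \<in># A" for r using that roots root_iff by auto
  \<comment> \<open>\<open>H\<close> is the quotient of \<open>h\<close> by \<open>g\<close>. Its
    last term accounts for the roots at infinity that the form of degree \<open>m\<close> has when
    \<open>degree g < m\<close>.\<close>
  define H where "H w = (q - p * w) * (\<Sum>r\<in>#A. 1 / (w - r)) + p * size A + p * (m - size A)"
    for w :: complex
  have hH: "poly h w = poly g w * H w" if "Im w \<noteq> 0" for w
  proof -
    have "w \<notin># A" using that Areal by (auto simp: complex_is_Real_iff)
    from poly_pderiv_prod_mset[OF this]
    have "poly (pderiv g) w = poly g w * (\<Sum>r\<in>#A. 1 / (w - r))"
      by (subst (1 2) A(2)) (simp add: pderiv_smult)
    moreover have "of_nat (size A) + of_nat (m - size A) = (of_nat m :: complex)"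
      using g(2) A(1) by (metis of_nat_add le_add_diff_inverse)
    then have m: "(of_nat m :: complex) = of_nat (size A) + of_nat (m - size A)" by simp
    ultimately show ?thesis
      unfolding h H_def by (simp add: m[symmetric]) (simp add: m algebra_simps)
  qed
  have "poly g z \<noteq> 0" using z roots by (auto simp: complex_is_Real_iff)
  then have H0: "H z = 0" using hH[OF z(2)] z(1) by simp
  have "Im ((q - p * z) * H z) = - Im z * (\<Sum>r\<in>#A. (q - p * Re r)\<^sup>2 / (cmod (z - r))\<^sup>2)
      - Im z * (p\<^sup>2 * (m - size A))"
  proof -
    have "(q - p * z) * H z = (q - p * z) * ((q - p * z) * (\<Sum>r\<in>#A. 1 / (z - r)) + p * size A)
      + (q - p * z) * (p * (m - size A))"
      unfolding H_def by (simp only: distrib_left)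
    moreover have "Im ((q - p * z) * (p * (m - size A))) = - Im z * (p\<^sup>2 * (m - size A))"
      by (simp add: power2_eq_square)
    ultimately show ?thesis using Im_polar_sum[OF z(2) Areal, of A q p] by simp
  qed
  then have "Im z * ((\<Sum>r\<in>#A. (q - p * Re r)\<^sup>2 / (cmod (z - r))\<^sup>2) + p\<^sup>2 * (m - size A)) = 0"
    using H0 by (simp add: algebra_simps)
  then have s0: "(\<Sum>r\<in>#A. (q - p * Re r)\<^sup>2 / (cmod (z - r))\<^sup>2) + p\<^sup>2 * (m - size A) = 0"
    using z(2) by simp
  have "(\<Sum>r\<in>#A. (q - p * Re r)\<^sup>2 / (cmod (z - r))\<^sup>2) \<ge> 0"
    by (induction A) auto
  moreover have "p\<^sup>2 * (m - size A) \<ge> 0" by simp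
  ultimately have s1: "(\<Sum>r\<in>#A. (q - p * Re r)\<^sup>2 / (cmod (z - r))\<^sup>2) = 0"
    and "p\<^sup>2 * (m - size A) = 0" using s0 by linarith+
  then have s2: "p * real (m - size A) = 0" by simp
  have qr: "of_real q = of_real p * r" if r: "r \<in># A" for r
  proof -
    have "(q - p * Re r)\<^sup>2 / (cmod (z - r))\<^sup>2 = 0"
      by (rule sum_mset_eq_0_nonneg[OF s1 _ r]) auto
    moreover have "z \<noteq> r" using Areal[OF r] z(2) by (auto simp: complex_is_Real_iff)
    ultimately have "q = p * Re r" by simp
    then show ?thesis using Areal[OF r] by (metis of_real_Re of_real_mult)
  qed
  \<comment> \<open>The relations \<open>q = p * r\<close> and \<open>p * (m - size A) = 0\<close>
    do not involve \<open>z\<close>, so one nonreal zero of \<open>H\<close> yields vanishing at all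
    nonreal points.\<close>
  have "H w = 0" if "Im w \<noteq> 0" for w
  proof -
    have "w \<noteq> r" if "r \<in># A" for r using Areal[OF that] \<open>Im w \<noteq> 0\<close> by (auto simp: complex_is_Real_iff)
    then have "(q - p * w) * (\<Sum>r\<in>#A. 1 / (w - r)) + p * size A = 0"
      using qr
    proof (induction A)
      case (add r A)
      then have "w - r \<noteq> 0" "of_real q - p * w = - p * (w - r)" by (auto simp: algebra_simps)
      then have "(of_real q - p * w) * (1 / (w - r)) + p = 0" by simp
      moreover have "(of_real q - p * w) * (\<Sum>r\<in>#A. 1 / (w - r)) + p * size A = 0" using add by auto
      ultimately have "((of_real q - p * w) * (1 / (w - r)) + p)
        + ((of_real q - p * w) * (\<Sum>r\<in>#A. 1 / (w - r)) + p * size A) = 0" by simp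
      then show ?case by (simp add: algebra_simps)
    qed simp
    moreover have "p * complex_of_real (real (m - size A)) = 0"
      using s2 by (metis of_real_mult of_real_0)
    ultimately show ?thesis unfolding H_def by simp
  qed
  then have "range (\<lambda>n. Complex 0 (real (Suc n))) \<subseteq> {w. poly h w = 0}"
    using hH by auto
  moreover have "infinite (range (\<lambda>n. Complex 0 (real (Suc n))))"
    by (rule range_inj_infinite) (auto simp: inj_def)
  ultimately show "h = 0" using poly_roots_finite finite_subset by blast
qed

section \<open>Real-rooted binary forms and polar derivatives\<close>

text \<open>A binary form with normalized coefficients, dehomogenized at \<open>u = 1\<close>. The
  formal degree \<open>m\<close> is a separate parameter because roots at infinity lower the
  polynomial degree.\<close>

definition bin_poly :: "nat \<Rightarrow> (nat \<Rightarrow> real) \<Rightarrow> complex poly" where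
  "bin_poly m a = (\<Sum>j\<le>m. monom (of_real (real (m choose j) * a j)) j)"

text \<open>Real-rootedness of the binary form \<open>\<Sum>j\<le>m. (m choose j) * a j * u ^ (m - j) * v ^ j\<close>;
  the zero form is included.\<close>

definition hyperbolic :: "nat \<Rightarrow> (nat \<Rightarrow> real) \<Rightarrow> bool" where
  "hyperbolic m a \<longleftrightarrow> (\<forall>j\<le>m. a j = 0) \<or> (\<forall>z. poly (bin_poly m a) z = 0 \<longrightarrow> z \<in> \<real>)"

lemma coeff_bin_poly: "coeff (bin_poly m a) j = of_real (real (m choose j) * a j)"
  by (simp add: bin_poly_def coeff_sum)

lemma poly_bin_poly: "poly (bin_poly m a) z = (\<Sum>j\<le>m. of_real (real (m choose j) * a j) * z ^ j)"
  by (simp add: bin_poly_def poly_sum poly_monom)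

lemma degree_bin_poly: "degree (bin_poly m a) \<le> m"
  by (rule degree_le) (simp add: coeff_bin_poly)

lemma bin_poly_eq_0_iff: "bin_poly m a = 0 \<longleftrightarrow> (\<forall>j\<le>m. a j = 0)"
  by (simp add: poly_eq_iff coeff_bin_poly) (metis not_less)

text \<open>By Euler's identity, the directional derivative \<open>p F_u + q F_v\<close> of a form
  \<open>F\<close> of degree \<open>Suc m\<close> becomes the left-hand side at
  \<open>u = 1\<close>. On coefficients this is the pair of absorption identities \<open>1\<close>
  and \<open>2\<close>.\<close>

lemma bin_poly_polar:
  "[:of_real q, - of_real p:] * pderiv (bin_poly (Suc m) a)
     + smult (of_real (p * real (Suc m))) (bin_poly (Suc m) a)
   = smult (of_nat (Suc m)) (bin_poly m (\<lambda>j. p * a j + q * a (Suc j)))"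
proof (rule poly_eqI)
  fix j
  have 1: "real (Suc j) * real (Suc m choose Suc j) = real (Suc m) * real (m choose j)"
    by (metis Suc_times_binomial of_nat_mult)
  have 2: "(real (Suc m) - real j) * real (Suc m choose j) = real (Suc m) * real (m choose j)"
  proof (cases "j \<le> Suc m")
    case True
    then show ?thesis
      by (metis binomial_absorb_comp of_nat_diff of_nat_mult diff_Suc_1)
  next
    case False
    then have "Suc m choose j = 0" "m choose j = 0" by (auto simp: binomial_eq_0)
    then show ?thesis by (simp only: of_nat_0 mult_zero_right)
  qed
  have 3: "coeff ([:0, - of_real p:] * pderiv (bin_poly (Suc m) a)) j
    = of_real (- p * real j * (real (Suc m choose j) * a j))"
    by (cases j) (auto simp: coeff_pderiv coeff_bin_poly simp del: binomial_Suc_Suc)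
  have 4: "[:of_real q, - of_real p:] * f = smult (of_real q) f + [:0, - of_real p:] * f" for f :: "complex poly"
    by simp
  have "q * (real (Suc j) * real (Suc m choose Suc j)) * a (Suc j) + (- p * real j * (real (Suc m choose j) * a j))
     + p * real (Suc m) * (real (Suc m choose j) * a j) =
     q * (real (Suc j) * real (Suc m choose Suc j)) * a (Suc j)
     + p * ((real (Suc m) - real j) * real (Suc m choose j)) * a j"
    by (simp add: algebra_simps del: binomial_Suc_Suc)
  also have "\<dots> = real (Suc m) * (real (m choose j) * (p * a j + q * a (Suc j)))"
    unfolding 1 2 by (simp only: algebra_simps)
  finally have 5: "q * (real (Suc j) * real (Suc m choose Suc j)) * a (Suc j) + (- p * real j * (real (Suc m choose j) * a j))
     + p * real (Suc m) * (real (Suc m choose j) * a j) = real (Suc m) * (real (m choose j) * (p * a j + q * a (Suc j)))" .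
  have "coeff ([:of_real q, - of_real p:] * pderiv (bin_poly (Suc m) a)
     + smult (of_real (p * real (Suc m))) (bin_poly (Suc m) a)) j
    = of_real (q * (real (Suc j) * real (Suc m choose Suc j)) * a (Suc j) + (- p * real j * (real (Suc m choose j) * a j))
     + p * real (Suc m) * (real (Suc m choose j) * a j))"
    unfolding coeff_add 4 3 by (simp add: coeff_pderiv coeff_bin_poly del: binomial_Suc_Suc)
  also have "\<dots> = coeff (smult (of_nat (Suc m)) (bin_poly m (\<lambda>j. p * a j + q * a (Suc j)))) j"
    unfolding 5 by (simp add: coeff_bin_poly)
  finally show "coeff ([:of_real q, - of_real p:] * pderiv (bin_poly (Suc m) a)
     + smult (of_real (p * real (Suc m))) (bin_poly (Suc m) a)) j
   = coeff (smult (of_nat (Suc m)) (bin_poly m (\<lambda>j. p * a j + q * a (Suc j)))) j" .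
qed

lemma hyperbolic_polar:
  assumes "hyperbolic (Suc m) a" "p \<noteq> 0 \<or> q \<noteq> 0"
  shows "hyperbolic m (\<lambda>j. p * a j + q * a (Suc j))"
proof (cases "\<forall>j\<le>Suc m. a j = 0")
  case True
  then show ?thesis by (simp add: hyperbolic_def)
next
  case False
  have "\<And>z. poly (bin_poly (Suc m) a) z = 0 \<Longrightarrow> z \<in> \<real>"
    using assms(1) False by (auto simp: hyperbolic_def)
  moreover have "bin_poly (Suc m) a \<noteq> 0" using False by (simp add: bin_poly_eq_0_iff)
  ultimately have "smult (of_nat (Suc m)) (bin_poly m (\<lambda>j. p * a j + q * a (Suc j))) = 0 \<or>
    (\<forall>z. poly (smult (of_nat (Suc m)) (bin_poly m (\<lambda>j. p * a j + q * a (Suc j)))) z = 0 \<longrightarrow> z \<in> \<real>)"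
    using laguerre[OF _ degree_bin_poly _ assms(2) refl, of "Suc m" a] unfolding bin_poly_polar by blast
  then show ?thesis
    by (simp add: hyperbolic_def bin_poly_eq_0_iff del: of_nat_Suc)
qed

text \<open>The derivative in direction \<open>(0, 1)\<close> removes the first coefficient, the one
  in direction \<open>(1, 0)\<close> the last.\<close>

lemma hyperbolic_window:
  assumes "hyperbolic N a" "l + M \<le> N"
  shows "hyperbolic M (\<lambda>j. a (l + j))"
proof -
  have shift: "hyperbolic (N - l) (\<lambda>j. a (l + j))" if "l \<le> N" for l
    using that
  proof (induction l)
    case (Suc l)
    then have "hyperbolic (Suc (N - Suc l)) (\<lambda>j. a (l + j))" by (simp add: Suc_diff_Suc)
    from hyperbolic_polar[OF this, of 0 1] show ?case by simp
  qed (use assms in simp)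
  have "hyperbolic (N - l - i) (\<lambda>j. a (l + j))" if "i \<le> N - l" for i
    using that
  proof (induction i)
    case (Suc i)
    then have "hyperbolic (Suc (N - l - Suc i)) (\<lambda>j. a (l + j))" by (simp add: Suc_diff_Suc)
    from hyperbolic_polar[OF this, of 1 0] show ?case by simp
  qed (use assms shift in simp)
  from this[of "N - l - M"] show ?thesis using assms(2) by simp
qed

lemma hyperbolic_newton:
  assumes "hyperbolic 2 b"
  shows "b 0 * b 2 \<le> (b 1)\<^sup>2"
proof (rule ccontr)
  assume *: "\<not> ?thesis"
  define D where "D = sqrt (b 0 * b 2 - (b 1)\<^sup>2)"
  have D: "D > 0" "D\<^sup>2 = b 0 * b 2 - (b 1)\<^sup>2" using * by (auto simp: D_def)
  have b2: "b 2 \<noteq> 0" using * by auto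
  define z where "z = Complex (- b 1 / b 2) (D / b 2)"
  have "poly (bin_poly 2 b) z = b 0 + 2 * b 1 * z + b 2 * z\<^sup>2"
    by (simp add: poly_bin_poly numeral_2_eq_2)
  also have "\<dots> = 0"
  proof (rule complex_eqI)
    have "b 2 * (b 0 - 2 * b 1 * b 1 / b 2 + b 2 * ((b 1 / b 2)\<^sup>2 - (D / b 2)\<^sup>2)) = 
       b 0 * b 2 - (b 1)\<^sup>2 - D\<^sup>2"
      using b2 by (simp add: field_simps power2_eq_square)
    then have "b 0 - 2 * b 1 * b 1 / b 2 + b 2 * ((b 1 / b 2)\<^sup>2 - (D / b 2)\<^sup>2) = 0"
      using D b2 by simp
    then show "Re (b 0 + 2 * b 1 * z + b 2 * z\<^sup>2) = Re 0"
      by (simp add: z_def power2_eq_square)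
    show "Im (b 0 + 2 * b 1 * z + b 2 * z\<^sup>2) = Im 0"
      using b2 by (simp add: z_def power2_eq_square field_simps)
  qed
  finally have "poly (bin_poly 2 b) z = 0" .
  moreover have "z \<notin> \<real>" using D b2 by (simp add: z_def complex_is_Real_iff)
  ultimately show False using assms b2 by (auto simp: hyperbolic_def)
qed

section \<open>Rigidity of powers of linear forms\<close>

lemma nonreal_root_exists:
  assumes "m \<ge> 3" "\<kappa> \<noteq> 0"
  shows "\<exists>w. w ^ m = complex_of_real \<kappa> \<and> Im w \<noteq> 0"
proof -
  have m: "real m \<ge> 3" using assms(1) by simp
  \<comment> \<open>The angle satisfies \<open>m * \<theta> = 2 * pi\<close> or
    \<open>m * \<theta> = pi\<close> according to the sign of \<open>\<kappa>\<close>;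
    \<open>m \<ge> 3\<close> keeps it strictly between \<open>0\<close> and
    \<open>pi\<close>.\<close>
  define \<theta> where "\<theta> = (if \<kappa> > 0 then 2 * pi / m else pi / m)"
  have "\<theta> > 0" "\<theta> < pi" using m by (auto simp: \<theta>_def field_simps)
  then have "sin \<theta> > 0" by (rule sin_gt_zero)
  moreover have "root m \<bar>\<kappa>\<bar> \<noteq> 0" using assms by simp
  ultimately have "Im (rcis (root m \<bar>\<kappa>\<bar>) \<theta>) \<noteq> 0" by simp
  moreover have "rcis (root m \<bar>\<kappa>\<bar>) \<theta> ^ m = rcis \<bar>\<kappa>\<bar> (m * \<theta>)"
    using assms(1) by (simp add: DeMoivre2)
  moreover have "rcis \<bar>\<kappa>\<bar> (m * \<theta>) = of_real \<kappa>"
    using m by (auto simp: \<theta>_def rcis_def cis.ctr complex_eq_iff)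
  ultimately show ?thesis by metis
qed

text \<open>The form vanishes where \<open>1 + \<rho> * z = w * (q - p * z)\<close> with
  \<open>w ^ m = - \<kappa> / c\<close>. As \<open>p + q * \<rho> \<noteq> 0\<close>, this is an
  invertible real Moebius relation between \<open>w\<close> and \<open>z\<close>, so a nonreal
  \<open>w\<close> gives a nonreal root.\<close>

lemma hyperbolic_sum_of_powers:
  fixes p q \<rho> c \<kappa> :: real
  assumes hyp: "hyperbolic m a" and nz: "\<exists>j\<le>m. a j \<noteq> 0" and m: "m \<ge> 3"
    and c: "c \<noteq> 0" and indep: "p + q * \<rho> \<noteq> 0"
    and eq: "\<And>z :: complex. poly (bin_poly m a) z = c * (1 + \<rho> * z) ^ m + \<kappa> * (q - p * z) ^ m"
  shows "\<kappa> = 0"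
proof (rule ccontr)
  assume "\<kappa> \<noteq> 0"
  then have "- \<kappa> / c \<noteq> 0" using c by simp
  then obtain w where w: "w ^ m = complex_of_real (- \<kappa> / c)" "Im w \<noteq> 0"
    using nonreal_root_exists[OF m] by blast
  define D where "D = \<rho> + w * p"
  have D: "D \<noteq> 0"
  proof
    assume "D = 0"
    then have "Im w * p = 0" "\<rho> + Re w * p = 0" by (auto simp: D_def complex_eq_iff)
    then show False using w(2) indep by auto
  qed
  define z where "z = (w * q - 1) / D"
  have zD: "z * D = w * q - 1" using D by (simp add: z_def)
  then have "1 + \<rho> * z = w * (q - p * z)" by (simp add: D_def algebra_simps)
  then have "poly (bin_poly m a) z = c * (w ^ m * (q - p * z) ^ m) + \<kappa> * (q - p * z) ^ m"
    unfolding eq by (simp only: power_mult_distrib)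
  also have "\<dots> = 0" unfolding w(1) using c by simp
  finally have "z \<in> \<real>" using hyp nz by (auto simp: hyperbolic_def)
  then obtain t where t: "z = of_real t" by (auto elim: Reals_cases)
  have "Im w * (t * p - q) = 0" "t * (\<rho> + Re w * p) = Re w * q - 1"
    using zD by (auto simp: t D_def complex_eq_iff algebra_simps)
  then have "q = t * p" "t * \<rho> = - 1" using w(2) by (auto simp: algebra_simps)
  moreover have "p + t * p * \<rho> = p * (1 + t * \<rho>)" by (simp add: algebra_simps)
  ultimately show False using indep by simp
qed

text \<open>Geometric coefficients encode a power of \<open>1 + \<rho> * z\<close>. The derivative
  determines \<open>a\<close> up to its kernel, spanned by the coefficients of
  \<open>(q - p * z) ^ Suc m\<close>, and real-rootedness in degree at least 3 excludes a kernel
  component.\<close>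

lemma hyperbolic_geometric_lift:
  fixes p q \<rho> c :: real
  assumes hyp: "hyperbolic (Suc m) a" and m: "m \<ge> 2" and c: "c \<noteq> 0" and pq: "p + q * \<rho> \<noteq> 0"
    and geo: "\<And>j. j \<le> m \<Longrightarrow> p * a j + q * a (Suc j) = c * \<rho> ^ j"
    and j: "j \<le> Suc m"
  shows "a j = c / (p + q * \<rho>) * \<rho> ^ j"
proof -
  define C where "C = c / (p + q * \<rho>)"
  have C: "C \<noteq> 0" "C * (p + q * \<rho>) = c" using c pq by (auto simp: C_def)
  define d where "d j = a j - C * \<rho> ^ j" for j
  have d: "p * d j + q * d (Suc j) = 0" if "j \<le> m" for j
  proof -
    have "p * d j + q * d (Suc j) = p * a j + q * a (Suc j) - C * (p + q * \<rho>) * \<rho> ^ j"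
      by (simp add: d_def algebra_simps)
    then show ?thesis using geo[OF that] C(2) by simp
  qed
  \<comment> \<open>The recursion for \<open>d\<close> has a one-dimensional solution space. If
    \<open>q = 0\<close>, only the last entry is free and fixes \<open>\<kappa>\<close>; otherwise
    \<open>d 0\<close> does.\<close>
  have "\<exists>\<kappa>. \<forall>j\<le>Suc m. d j = \<kappa> * (q ^ (Suc m - j) * (- p) ^ j)"
  proof (cases "q = 0")
    case True
    then have p: "p \<noteq> 0" using pq by auto
    have "d j = d (Suc m) / (- p) ^ Suc m * (q ^ (Suc m - j) * (- p) ^ j)" if "j \<le> Suc m" for j
    proof (cases "j = Suc m")
      case False
      then show ?thesis using d[of j] that p True by simp
    qed (use p in simp)
    then show ?thesis by blast
  next
    case False
    have 1: "d j * q ^ j = d 0 * (- p) ^ j" if "j \<le> Suc m" for j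
      using that
    proof (induction j)
      case (Suc j)
      then have "q * d (Suc j) = - p * d j" using d[of j] by simp
      moreover have "d (Suc j) * q ^ Suc j = (q * d (Suc j)) * q ^ j" by simp
      ultimately have "d (Suc j) * q ^ Suc j = - p * (d j * q ^ j)" by simp
      then show ?case using Suc by simp
    qed simp
    have "d j = d 0 / q ^ Suc m * (q ^ (Suc m - j) * (- p) ^ j)" if "j \<le> Suc m" for j
    proof -
      have "q ^ Suc m = q ^ (Suc m - j) * q ^ j" using that by (simp flip: power_add)
      then have "d 0 / q ^ Suc m * (q ^ (Suc m - j) * (- p) ^ j) = (d 0 * (- p) ^ j) / q ^ j"
        using False by simp
      moreover have "d j = (d 0 * (- p) ^ j) / q ^ j"
        using 1[OF that] False by (simp add: eq_divide_eq)
      ultimately show ?thesis by (simp only:)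
    qed
    then show ?thesis by blast
  qed
  then obtain \<kappa> where \<kappa>: "d j = \<kappa> * (q ^ (Suc m - j) * (- p) ^ j)" if "j \<le> Suc m" for j by blast
  have "poly (bin_poly (Suc m) a) z
    = C * (1 + \<rho> * z) ^ Suc m + \<kappa> * (q - p * z) ^ Suc m" for z :: complex
  proof -
    have 1: "(1 + \<rho> * z) ^ Suc m = (\<Sum>j\<le>Suc m. of_nat (Suc m choose j) * (of_real \<rho> * z) ^ j)"
      using binomial_ring[of "\<rho> * z" 1 "Suc m"] by (simp only: add.commute power_one mult_1_right)
    have 2: "(q - p * z) ^ Suc m = (\<Sum>j\<le>Suc m. of_nat (Suc m choose j) * (- of_real p * z) ^ j * of_real q ^ (Suc m - j))"
      using binomial_ring[of "- of_real p * z" "of_real q" "Suc m"] by (simp only: minus_mult_left[symmetric] uminus_add_conv_diff)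
    have "poly (bin_poly (Suc m) a) z = (\<Sum>j\<le>Suc m. C * (of_nat (Suc m choose j) * (of_real \<rho> * z) ^ j)
        + \<kappa> * (of_nat (Suc m choose j) * (- of_real p * z) ^ j * of_real q ^ (Suc m - j)))"
      unfolding poly_bin_poly
    proof (rule sum.cong)
      fix j assume "j \<in> {..Suc m}"
      then have "a j = C * \<rho> ^ j + \<kappa> * (q ^ (Suc m - j) * (- p) ^ j)" using \<kappa>[of j] by (simp add: d_def)
      then show "of_real (real (Suc m choose j) * a j) * z ^ j =
        C * (of_nat (Suc m choose j) * (of_real \<rho> * z) ^ j)
        + \<kappa> * (of_nat (Suc m choose j) * (- of_real p * z) ^ j * of_real q ^ (Suc m - j))"
        by (simp add: algebra_simps power_mult_distrib power_minus' del: binomial_Suc_Suc)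
    qed simp
    then show ?thesis unfolding 1 2 by (simp only: sum.distrib sum_distrib_left)
  qed
  moreover have "\<exists>j\<le>Suc m. a j \<noteq> 0"
  proof (rule ccontr)
    assume "\<not> ?thesis"
    then show False using geo[of 0] c by simp
  qed
  ultimately have "\<kappa> = 0" using hyperbolic_sum_of_powers[OF hyp _ _ C(1) pq] m by simp
  then show ?thesis using \<kappa>[OF j] by (simp add: d_def C_def)
qed

section \<open>Absence of internal zeros\<close>

text \<open>A single zero between the two entries is handled by Newton's inequality. A longer gap
  leaves a form \<open>b 0 + b M * z ^ M\<close> with \<open>M \<ge> 3\<close>, which has nonreal
  roots unless one end vanishes.\<close>

lemma hyperbolic_gap:
  assumes hyp: "hyperbolic N t" and ij: "i < j" "j < N" and zero: "\<And>l. i < l \<Longrightarrow> l \<le> j \<Longrightarrow> t l = 0"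
  shows "t i * t (Suc j) \<le> 0"
proof (cases "j = Suc i")
  case True
  with ij have "hyperbolic 2 (\<lambda>l. t (i + l))" by (intro hyperbolic_window[OF hyp]) auto
  from hyperbolic_newton[OF this] zero[of j] True show ?thesis by simp
next
  case False
  define M where "M = Suc j - i"
  define b where "b l = t (i + l)" for l
  have M: "M \<ge> 3" "i + M = Suc j" using False ij by (auto simp: M_def)
  have b: "hyperbolic M b" unfolding b_def using M ij by (intro hyperbolic_window[OF hyp]) auto
  have "poly (bin_poly M b) z = b 0 * (1 + 0 * z) ^ M + b M * (0 - (-1) * z) ^ M" for z :: complex
  proof -
    have "poly (bin_poly M b) z = (\<Sum>l\<in>{0, M}. of_real (real (M choose l) * b l) * z ^ l)"
      unfolding poly_bin_poly
    proof (rule sum.mono_neutral_right)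
      have "b l = 0" if "l \<le> M" "l \<noteq> 0" "l \<noteq> M" for l
        unfolding b_def using that M by (intro zero) auto
      then show "\<forall>l\<in>{..M} - {0, M}. complex_of_real (real (M choose l) * b l) * z ^ l = 0" by auto
    qed auto
    then show ?thesis using M by simp
  qed
  then have "b M = 0" if "b 0 \<noteq> 0"
    using hyperbolic_sum_of_powers[OF b _ M(1) that, of "- 1" 0 0 "b M"] that by auto
  then show ?thesis using M by (cases "b 0 = 0") (auto simp: b_def)
qed

lemma hyperbolic_zero_Suc:
  assumes hyp: "hyperbolic N t" and r: "r \<le> N" "\<And>i. i \<le> r \<Longrightarrow> t i \<ge> 0"
    and "t 0 > 0" and j: "j < r" "t j = 0"
  shows "t (Suc j) = 0"
proof -
  \<comment> \<open>The last nonzero entry up to \<open>j\<close>; it exists since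
    \<open>t 0 > 0\<close>. Only zeros separate it from \<open>Suc j\<close>.\<close>
  define i where "i = (GREATEST i. i \<le> j \<and> t i \<noteq> 0)"
  have i: "i \<le> j \<and> t i \<noteq> 0" unfolding i_def
    by (rule GreatestI_nat[where b = j and k = 0]) (use assms in auto)
  have "t l = 0" if "i < l" "l \<le> j" for l
  proof (rule ccontr)
    assume "t l \<noteq> 0"
    then have "l \<le> i" unfolding i_def using that by (intro Greatest_le_nat[where b = j]) auto
    then show False using that by simp
  qed
  moreover have "i < j" using i j by (cases "i = j") auto
  ultimately have "t i * t (Suc j) \<le> 0" using j r by (intro hyperbolic_gap[OF hyp]) auto
  moreover have "t i > 0" using i r(2)[of i] j by auto
  ultimately have "t (Suc j) \<le> 0" by (simp add: mult_le_0_iff)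
  then show ?thesis using r(2)[of "Suc j"] j by simp
qed

section \<open>Binomial convolution and real-rootedness of the means\<close>

text \<open>Stated for arbitrary sequences so that it also applies to a truncation of the
  means.\<close>

definition binomial_conv :: "real \<Rightarrow> nat \<Rightarrow> (int \<Rightarrow> real) \<Rightarrow> int \<Rightarrow> real" where
  "binomial_conv \<alpha> s a k = (\<Sum>i=0..s. real (s choose i) * \<alpha> ^ i * a (k - int i))"

lemma binomial_conv_0 [simp]: "binomial_conv \<alpha> 0 a k = a k"
  by (simp add: binomial_conv_def)

text \<open>Pascal's rule: the weights are the coefficients of \<open>(1 + \<alpha> X) ^ s\<close>,
  and one more factor is split off.\<close>

lemma binomial_conv_Suc:
  "binomial_conv \<alpha> (Suc s) a k = binomial_conv \<alpha> s a k + \<alpha> * binomial_conv \<alpha> s a (k - 1)"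
proof -
  have "binomial_conv \<alpha> (Suc s) a k = a k
    + (\<Sum>i=0..s. real (Suc s choose Suc i) * \<alpha> ^ Suc i * a (k - int (Suc i)))"
    unfolding binomial_conv_def sum.atLeast0_atMost_Suc_shift by simp
  also have "\<dots> = (a k + (\<Sum>i=0..s. real (s choose Suc i) * \<alpha> ^ Suc i * a (k - int (Suc i))))
    + (\<Sum>i=0..s. \<alpha> * (real (s choose i) * \<alpha> ^ i * a (k - 1 - int i)))"
    by (simp add: algebra_simps flip: sum.distrib)
  also have "a k + (\<Sum>i=0..s. real (s choose Suc i) * \<alpha> ^ Suc i * a (k - int (Suc i)))
    = (\<Sum>i=0..Suc s. real (s choose i) * \<alpha> ^ i * a (k - int i))"
    unfolding sum.atLeast0_atMost_Suc_shift by simp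
  also have "\<dots> = binomial_conv \<alpha> s a k" by (simp add: binomial_conv_def binomial_eq_0)
  finally show ?thesis by (simp only: binomial_conv_def sum_distrib_left)
qed

lemma S_mean_conv: "S_mean \<alpha> k s x = binomial_conv \<alpha> s (\<lambda>k. E_mean k x) k"
  by (simp add: S_mean_def binomial_conv_def)

lemma S_mean_0 [simp]: "S_mean \<alpha> k 0 x = E_mean k x"
  by (simp add: S_mean_conv)

lemma S_mean_Suc: "S_mean \<alpha> k (Suc s) x = S_mean \<alpha> k s x + \<alpha> * S_mean \<alpha> (k - 1) s x"
  by (simp add: S_mean_conv binomial_conv_Suc)

lemma S_mean_alpha_0: "S_mean 0 k s x = E_mean k x"
  by (induction s) (auto simp: S_mean_Suc)

lemma poly_bin_poly_E_mean:
  fixes x :: "real ^ 'n"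
  shows "poly (bin_poly CARD('n) (\<lambda>j. E_mean (int j) x)) z = (\<Prod>i\<in>UNIV. of_real (x $ i) * z + 1)"
proof -
  have "(\<Prod>i\<in>UNIV. of_real (x $ i) * z + 1)
    = (\<Sum>X\<in>Pow (UNIV :: 'n set). of_real (\<Prod>i\<in>X. x $ i) * z ^ card X)"
    by (subst prod_add) (auto simp: prod.distrib)
  also have "\<dots> = (\<Sum>j\<in>{..CARD('n)}. \<Sum>X\<in>{X \<in> Pow (UNIV :: 'n set). card X = j}.
      of_real (\<Prod>i\<in>X. x $ i) * z ^ card X)"
    by (rule sum.group[symmetric]) (auto intro: card_mono)
  also have "\<dots> = (\<Sum>j\<in>{..CARD('n)}. of_real (real (CARD('n) choose j) * E_mean (int j) x) * z ^ j)"
  proof (rule sum.cong)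
    fix j assume "j \<in> {..CARD('n)}"
    then have "real (CARD('n) choose j) * E_mean (int j) x = elem_symm j x"
      by (simp add: E_mean_def)
    moreover have "(\<Sum>X\<in>{X \<in> Pow (UNIV :: 'n set). card X = j}. of_real (\<Prod>i\<in>X. x $ i) * z ^ card X)
      = (\<Sum>X\<in>{X \<in> Pow (UNIV :: 'n set). card X = j}. of_real (\<Prod>i\<in>X. x $ i) * z ^ j)"
      by (rule sum.cong) auto
    ultimately show "(\<Sum>X\<in>{X \<in> Pow (UNIV :: 'n set). card X = j}. of_real (\<Prod>i\<in>X. x $ i) * z ^ card X)
      = of_real (real (CARD('n) choose j) * E_mean (int j) x) * z ^ j"
      by (simp add: elem_symm_def sum_distrib_right)
  qed simp
  finally show ?thesis by (simp add: poly_bin_poly)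
qed

lemma hyperbolic_E_mean:
  fixes x :: "real ^ 'n"
  shows "hyperbolic CARD('n) (\<lambda>j. E_mean (int j) x)"
  unfolding hyperbolic_def
proof (intro disjI2 allI impI)
  fix z assume "poly (bin_poly CARD('n) (\<lambda>j. E_mean (int j) x)) z = 0"
  then obtain i where "of_real (x $ i) * z + 1 = 0" by (auto simp: poly_bin_poly_E_mean)
  then have "x $ i \<noteq> 0" "of_real (x $ i) * z = - 1" by (auto simp: eq_neg_iff_add_eq_0)
  then have "z = of_real (- 1 / x $ i)" by (simp add: field_simps)
  then show "z \<in> \<real>" by (metis Reals_of_real)
qed

text \<open>Each step is a polar derivative in direction \<open>(\<alpha>, 1)\<close>. The offset
  \<open>s\<close> keeps all indices of \<open>E_mean\<close> between \<open>0\<close> and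
  \<open>CARD('n)\<close>.\<close>

lemma hyperbolic_S_mean:
  fixes x :: "real ^ 'n"
  assumes "s \<le> CARD('n)"
  shows "hyperbolic (CARD('n) - s) (\<lambda>j. S_mean \<alpha> (int (s + j)) s x)"
  using assms
proof (induction s)
  case 0
  then show ?case using hyperbolic_E_mean by simp
next
  case (Suc s)
  then have "hyperbolic (Suc (CARD('n) - Suc s)) (\<lambda>j. S_mean \<alpha> (int (s + j)) s x)"
    by (simp add: Suc_diff_Suc)
  from hyperbolic_polar[OF this, of \<alpha> 1]
  show ?case by (simp add: S_mean_Suc algebra_simps)
qed

lemma S_mean_newton:
  fixes x :: "real ^ 'n"
  assumes "int s + 1 \<le> k" "k \<le> int CARD('n) - 1"
  shows "S_mean \<alpha> (k - 1) s x * S_mean \<alpha> (k + 1) s x \<le> (S_mean \<alpha> k s x)\<^sup>2"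
proof -
  \<comment> \<open>The position of \<open>S_mean\<close> at \<open>k - 1\<close> in the sequence
    shifted by \<open>s\<close>.\<close>
  define l where "l = nat (k - 1) - s"
  have l: "k = int (s + (l + 1))" "l + 2 \<le> CARD('n) - s" using assms by (auto simp: l_def)
  from hyperbolic_newton[OF hyperbolic_window[OF hyperbolic_S_mean l(2)]] l(2)
  show ?thesis unfolding l(1) by (simp add: algebra_simps)
qed

section \<open>The equality case of Newton's inequality\<close>

lemma E_mean_CARD:
  fixes x :: "real ^ 'n"
  shows "E_mean (int CARD('n)) x = (\<Prod>i\<in>UNIV. x $ i)"
proof -
  have "{I. I \<subseteq> (UNIV :: 'n set) \<and> card I = CARD('n)} = {UNIV}"
    by (auto dest!: card_eq_UNIV_imp_eq_UNIV[OF finite])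
  then show ?thesis by (simp add: E_mean_def elem_symm_def)
qed

text \<open>The generating product becomes \<open>(1 + \<rho> * z) ^ CARD('n)\<close>, so the root
  \<open>- 1 / x $ i\<close> of each factor must be \<open>- 1 / \<rho>\<close>.\<close>

lemma E_mean_geometric_imp_const:
  fixes x :: "real ^ 'n"
  assumes geo: "\<And>j. j \<le> CARD('n) \<Longrightarrow> E_mean (int j) x = \<rho> ^ j" and "\<rho> \<noteq> 0"
  shows "x $ i = \<rho>"
proof -
  have "(\<Prod>i\<in>UNIV. x $ i) \<noteq> 0" using geo[of "CARD('n)"] \<open>\<rho> \<noteq> 0\<close> by (simp flip: E_mean_CARD)
  then have xi: "x $ i \<noteq> 0" by simp
  define z :: complex where "z = of_real (- 1 / x $ i)"
  have "of_real (x $ i) * z + 1 = 0" using xi by (simp add: z_def)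
  then have "0 = (\<Prod>i\<in>UNIV. of_real (x $ i) * z + 1)" by (metis (mono_tags) finite iso_tuple_UNIV_I prod_zero)
  also have "\<dots> = (\<Sum>j\<le>CARD('n). of_nat (CARD('n) choose j) * (\<rho> * z) ^ j * 1 ^ (CARD('n) - j))"
    unfolding poly_bin_poly_E_mean[symmetric] poly_bin_poly
    by (intro sum.cong) (auto simp: geo power_mult_distrib)
  also have "\<dots> = (\<rho> * z + 1) ^ CARD('n)" by (rule binomial_ring[symmetric])
  finally have "\<rho> * z + 1 = 0" by simp
  then have "complex_of_real (1 - \<rho> / x $ i) = 0" by (simp add: z_def)
  then show ?thesis using xi by (simp only: of_real_eq_0_iff) (simp add: field_simps)
qed

lemma E_mean_geometric_window_imp_const:
  fixes x :: "real ^ 'n"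
  assumes "l + m \<le> CARD('n)" "m \<ge> 2" "c \<noteq> 0" "\<rho> \<noteq> 0"
    and geo: "\<And>j. j \<le> m \<Longrightarrow> E_mean (int (l + j)) x = c * \<rho> ^ j"
  shows "x $ i = \<rho>"
proof -
  \<comment> \<open>Leftward extension by undoing derivatives in direction \<open>(0, 1)\<close>,
    where the lift needs \<open>\<rho> \<noteq> 0\<close>. On reaching index 0,
    \<open>E_mean 0 x = 1\<close> fixes \<open>c\<close>; direction \<open>(1, 0)\<close> then
    extends to the right.\<close>
  have "\<exists>c. c \<noteq> 0 \<and> (\<forall>j\<le>m + t. E_mean (int (l - t + j)) x = c * \<rho> ^ j)" if "t \<le> l" for t
    using that
  proof (induction t)
    case 0
    then show ?case using assms by auto
  next
    case (Suc t)
    then obtain c where c: "c \<noteq> 0" "\<forall>j\<le>m + t. E_mean (int (l - t + j)) x = c * \<rho> ^ j" by auto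
    have "l - Suc t + Suc (m + t) \<le> CARD('n)" using Suc.prems assms by linarith
    note h = hyperbolic_window[OF hyperbolic_E_mean this]
    have e: "l - Suc t + Suc j = l - t + j" for j using Suc.prems by simp
    have "0 * E_mean (int (l - Suc t + j)) x + 1 * E_mean (int (l - Suc t + Suc j)) x = c * \<rho> ^ j"
      if "j \<le> m + t" for j
      using c(2)[rule_format, OF that] by (simp only: e mult_zero_left mult_1 add_0)
    from hyperbolic_geometric_lift[OF h _ c(1) _ this] assms
    have "\<forall>j\<le>m + Suc t. E_mean (int (l - Suc t + j)) x = c / \<rho> * \<rho> ^ j" by auto
    moreover have "c / \<rho> \<noteq> 0" using c assms by simp
    ultimately show ?case by blast
  qed
  from this[of l] obtain c where c: "c \<noteq> 0" "\<forall>j\<le>m + l. E_mean (int j) x = c * \<rho> ^ j" by auto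
  have c1: "c = 1" using c(2)[rule_format, of 0] by (simp add: E_mean_0)
  have "\<forall>j\<le>M. E_mean (int j) x = 1 * \<rho> ^ j" if "m + l \<le> M" "M \<le> CARD('n)" for M
    using that
  proof (induction M rule: dec_induct)
    case base
    then show ?case using c c1 by simp
  next
    case (step M)
    from step.prems have "0 + Suc M \<le> CARD('n)" by simp
    note h = hyperbolic_window[OF hyperbolic_E_mean this]
    have "1 * E_mean (int (0 + j)) x + 0 * E_mean (int (0 + Suc j)) x = 1 * \<rho> ^ j"
      if "j \<le> M" for j using step that by simp
    from hyperbolic_geometric_lift[OF h _ _ _ this] assms step.hyps
    show ?case by auto
  qed
  from this[of "CARD('n)"] assms have "E_mean (int j) x = \<rho> ^ j" if "j \<le> CARD('n)" for j
    using that by simp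
  from E_mean_geometric_imp_const[OF this \<open>\<rho> \<noteq> 0\<close>] show ?thesis .
qed

lemma S_mean_newton_eq:
  fixes x :: "real ^ 'n"
  assumes k: "int s + 1 \<le> k" "k \<le> int CARD('n) - 1"
    and eq: "(S_mean \<alpha> k s x)\<^sup>2 = S_mean \<alpha> (k - 1) s x * S_mean \<alpha> (k + 1) s x"
    and nz: "S_mean \<alpha> k s x \<noteq> 0"
    and ratio: "S_mean \<alpha> k s x / S_mean \<alpha> (k - 1) s x \<noteq> - \<alpha>"
  shows "x $ i = x $ j"
proof -
  define \<rho> where "\<rho> = S_mean \<alpha> k s x / S_mean \<alpha> (k - 1) s x"
  have nz': "S_mean \<alpha> (k - 1) s x \<noteq> 0" using eq nz by auto
  have \<rho>: "\<rho> \<noteq> 0" "\<alpha> + \<rho> \<noteq> 0" using nz nz' ratio by (auto simp: \<rho>_def add_eq_0_iff)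
  define l where "l = nat (k - 1) - s"
  have l: "k = int (l + s) + 1" "l + s + 2 \<le> CARD('n)" using k by (auto simp: l_def)
  \<comment> \<open>Equality makes three consecutive values geometric with ratio
    \<open>\<rho>\<close>. Undoing \<open>t\<close> derivatives in direction
    \<open>(\<alpha>, 1)\<close> lengthens this window to \<open>3 + t\<close> entries; each lift
    needs \<open>\<alpha> + \<rho> \<noteq> 0\<close>.\<close>
  have "\<exists>c. c \<noteq> 0 \<and> (\<forall>j\<le>2 + t. S_mean \<alpha> (int (l + (s - t) + j)) (s - t) x = c * \<rho> ^ j)" if "t \<le> s" for t
    using that
  proof (induction t)
    case 0
    have "S_mean \<alpha> (k - 1 + int j) s x = S_mean \<alpha> (k - 1) s x * \<rho> ^ j" if "j \<le> 2" for j
    proof -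
      have "S_mean \<alpha> (k + 1) s x = S_mean \<alpha> (k - 1) s x * \<rho>\<^sup>2"
        using eq nz' by (simp add: \<rho>_def field_simps power2_eq_square)
      moreover have "S_mean \<alpha> k s x = S_mean \<alpha> (k - 1) s x * \<rho>" using nz' by (simp add: \<rho>_def)
      moreover have "j = 0 \<or> j = 1 \<or> j = 2" using that by auto
      ultimately show ?thesis by (auto simp: algebra_simps)
    qed
    then show ?case using nz' l(1) by auto
  next
    case (Suc t)
    define u where "u = s - Suc t"
    have u: "s - t = Suc u" "u + Suc t = s" using Suc.prems by (auto simp: u_def)
    from Suc u obtain c where c: "c \<noteq> 0"
      "\<forall>j\<le>2 + t. S_mean \<alpha> (int (l + Suc u + j)) (Suc u) x = c * \<rho> ^ j" by auto
    have "l + Suc (2 + t) \<le> CARD('n) - u" "u \<le> CARD('n)" using l(2) u by auto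
    note h = hyperbolic_window[OF hyperbolic_S_mean[OF this(2)] this(1)]
    have "\<alpha> * S_mean \<alpha> (int (u + (l + j))) u x + 1 * S_mean \<alpha> (int (u + (l + Suc j))) u x = c * \<rho> ^ j"
      if "j \<le> 2 + t" for j
      using c(2)[rule_format, OF that] by (simp add: S_mean_Suc algebra_simps)
    from hyperbolic_geometric_lift[OF h _ c(1) _ this] \<rho>
    have "\<forall>j\<le>2 + Suc t. S_mean \<alpha> (int (l + u + j)) u x = c / (\<alpha> + \<rho>) * \<rho> ^ j"
      by (auto simp: add_ac)
    moreover have "c / (\<alpha> + \<rho>) \<noteq> 0" using c \<rho> by simp
    ultimately show ?case unfolding u_def by blast
  qed
  from this[of s] obtain c where c: "c \<noteq> 0" "\<forall>j\<le>s + 2. E_mean (int (l + j)) x = c * \<rho> ^ j"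
    by (auto simp: add_ac)
  then have "x $ i = \<rho>" for i
    using l(2) \<rho>(1) by (intro E_mean_geometric_window_imp_const[of l "s + 2" c]) auto
  then show ?thesis by simp
qed

section \<open>Log-concavity under convolution and the low indices\<close>

text \<open>Log-concavity without internal zeros, in the form of nonnegative \<open>2 \<times> 2\<close> minors.\<close>

definition minors_nonneg :: "(int \<Rightarrow> real) \<Rightarrow> bool" where
  "minors_nonneg a \<longleftrightarrow> (\<forall>i j. i \<le> j \<longrightarrow> a (i - 1) * a (j + 1) \<le> a i * a j)"

text \<open>For one factor \<open>1 + \<alpha> X\<close>, the new minor is a polynomial in
  \<open>\<alpha>\<close> whose coefficients are nonnegative by the old minor inequalities.\<close>

lemma minors_nonneg_conv:
  assumes "\<alpha> \<ge> 0" "minors_nonneg a"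
  shows "minors_nonneg (binomial_conv \<alpha> s a)"
proof (induction s)
  case 0
  then show ?case using assms by (simp add: minors_nonneg_def)
next
  case (Suc s)
  define b where "b = binomial_conv \<alpha> s a"
  have b: "b (i - 1) * b (j + 1) \<le> b i * b j" if "i \<le> j" for i j
    using Suc that by (auto simp: minors_nonneg_def b_def)
  have "(b (i - 1) + \<alpha> * b (i - 1 - 1)) * (b (j + 1) + \<alpha> * b (j + 1 - 1))
     \<le> (b i + \<alpha> * b (i - 1)) * (b j + \<alpha> * b (j - 1))" if "i \<le> j" for i j
  proof -
    have 1: "b (i - 1) * b (j + 1) \<le> b i * b j" using b that by simp
    have 2: "b (i - 2) * b j \<le> b (i - 1) * b (j - 1)" using b[of "i - 1" "j - 1"] that by simp
    \<comment> \<open>The coefficient of \<open>\<alpha>\<close> needs two minors chained through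
      \<open>b (i - 1) * b j\<close>; for \<open>i = j\<close> the second is an equality.\<close>
    have "b (i - 2) * b (j + 1) \<le> b (i - 1) * b j" using b[of "i - 1" j] that by simp
    also have "\<dots> \<le> b i * b (j - 1)"
      using b[of i "j - 1"] that by (cases "i = j") auto
    finally have 3: "b (i - 2) * b (j + 1) \<le> b i * b (j - 1)" .
    have "(b i + \<alpha> * b (i - 1)) * (b j + \<alpha> * b (j - 1))
       - (b (i - 1) + \<alpha> * b (i - 2)) * (b (j + 1) + \<alpha> * b j)
       = (b i * b j - b (i - 1) * b (j + 1)) + \<alpha> * (b i * b (j - 1) - b (i - 2) * b (j + 1))
       + \<alpha>\<^sup>2 * (b (i - 1) * b (j - 1) - b (i - 2) * b j)"
      by (simp add: algebra_simps power2_eq_square)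
    also have "\<dots> \<ge> 0" using 1 2 3 assms(1) by (intro add_nonneg_nonneg mult_nonneg_nonneg) auto
    finally show ?thesis by simp
  qed
  then show ?case unfolding minors_nonneg_def binomial_conv_Suc b_def by blast
qed

text \<open>While the entries are positive, \<open>lc\<close> says that the ratios
  \<open>t (Suc i) / t i\<close> decrease, and a minor compares two such ratios. After the first
  zero everything vanishes, and extending by zero only adds minors with zero left-hand side.\<close>

lemma minors_nonneg_truncate:
  fixes t :: "nat \<Rightarrow> real"
  assumes nonneg: "\<And>i. i \<le> r \<Longrightarrow> t i \<ge> 0"
    and lc: "\<And>i. Suc i < r \<Longrightarrow> t i * t (Suc (Suc i)) \<le> (t (Suc i))\<^sup>2"
    and zero: "\<And>i. i < r \<Longrightarrow> t i = 0 \<Longrightarrow> t (Suc i) = 0"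
  shows "minors_nonneg (\<lambda>k. if 0 \<le> k \<and> k \<le> int r then t (nat k) else 0)"
proof -
  have zeros: "t j = 0" if "i \<le> j" "j \<le> r" "t i = 0" for i j
    using that by (induction j rule: dec_induct) (auto intro: zero)
  have minor: "t i * t (Suc j) \<le> t (Suc i) * t j" if "Suc i \<le> j" "Suc j \<le> r" for i j
    using that
  proof (induction j rule: dec_induct)
    case base
    then show ?case using lc[of i] by (simp add: power2_eq_square)
  next
    case (step j)
    show ?case
    proof (cases "t (Suc j) = 0")
      case True
      then have "t (Suc (Suc j)) = 0" using zero step by simp
      with True show ?thesis by simp
    next
      case False
      then have "t j \<noteq> 0" using zeros[of j "Suc j"] step by auto
      then have pos: "t j > 0" "t (Suc j) > 0"
        using False nonneg[of j] nonneg[of "Suc j"] step by auto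
      have "(t i * t (Suc j)) * (t j * t (Suc (Suc j))) \<le> (t (Suc i) * t j) * (t (Suc j))\<^sup>2"
        by (rule mult_mono)
          (use step lc[of j] pos nonneg[of "Suc i"] nonneg[of "Suc (Suc j)"] in auto)
      then have "(t j * t (Suc j)) * (t i * t (Suc (Suc j))) \<le> (t j * t (Suc j)) * (t (Suc i) * t (Suc j))"
        by (simp add: power2_eq_square mult_ac)
      then show ?thesis using pos by (simp only: mult_le_cancel_left_pos mult_pos_pos)
    qed
  qed
  show ?thesis
    unfolding minors_nonneg_def
  proof (intro allI impI)
    fix i j :: int
    assume "i \<le> j"
    define a where "a k = (if 0 \<le> k \<and> k \<le> int r then t (nat k) else 0)" for k
    have a0: "a k \<ge> 0" for k using nonneg by (auto simp: a_def)
    have "a (i - 1) * a (j + 1) \<le> a i * a j"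
    proof (cases "i \<ge> 1 \<and> j + 1 \<le> int r")
      case True
      then have n: "nat (i - 1) + 1 = nat i" "nat (j + 1) = nat j + 1"
        using \<open>i \<le> j\<close> by auto
      have "t (nat (i - 1)) * t (Suc (nat j)) \<le> t (Suc (nat (i - 1))) * t (nat j)"
        using True \<open>i \<le> j\<close> by (intro minor) auto
      then show ?thesis using True \<open>i \<le> j\<close> n by (simp add: a_def)
    next
      case False
      then have "a (i - 1) * a (j + 1) = 0" by (auto simp: a_def)
      then show ?thesis using mult_nonneg_nonneg[OF a0 a0] by metis
    qed
    then show "(if 0 \<le> i - 1 \<and> i - 1 \<le> int r then t (nat (i - 1)) else 0) *
        (if 0 \<le> j + 1 \<and> j + 1 \<le> int r then t (nat (j + 1)) else 0)
      \<le> (if 0 \<le> i \<and> i \<le> int r then t (nat i) else 0) * (if 0 \<le> j \<and> j \<le> int r then t (nat j) else 0)"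
      unfolding a_def .
  qed
qed

lemma S_mean_newton_low:
  fixes x :: "real ^ 'n"
  assumes "\<alpha> \<ge> 0" and E: "\<And>i. i \<in> {1..s} \<Longrightarrow> E_mean (int i) x \<ge> 0"
    and j: "1 \<le> j" "j \<le> int s" "j \<le> int CARD('n) - 1"
  shows "S_mean \<alpha> (j - 1) s x * S_mean \<alpha> (j + 1) s x \<le> (S_mean \<alpha> j s x)\<^sup>2"
proof -
  \<comment> \<open>The mean at \<open>Suc s\<close> may be negative and is then replaced by 0. For
    \<open>j \<le> s\<close> this leaves the values at \<open>j - 1\<close> and \<open>j\<close>
    unchanged and can only increase the one at \<open>j + 1\<close>, so the inequality for the
    truncated sequence suffices.\<close>
  define r where "r = (if Suc s \<le> CARD('n) \<and> E_mean (int (Suc s)) x \<ge> 0 then Suc s else min s CARD('n))"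
  define a where "a k = (if 0 \<le> k \<and> k \<le> int r then E_mean (int (nat k)) x else 0)" for k
  have r: "r \<le> CARD('n)" by (simp add: r_def)
  have nonneg: "E_mean (int i) x \<ge> 0" if "i \<le> r" for i
  proof -
    have "i = 0 \<or> i \<in> {1..s} \<or> i = Suc s \<and> E_mean (int (Suc s)) x \<ge> 0"
      using that by (auto simp: r_def split: if_splits)
    then show ?thesis using E E_mean_0[of x] by auto
  qed
  have "minors_nonneg a" unfolding a_def
  proof (rule minors_nonneg_truncate)
    fix i assume "Suc i < r"
    then show "E_mean (int i) x * E_mean (int (Suc (Suc i))) x \<le> (E_mean (int (Suc i)) x)\<^sup>2"
      using S_mean_newton[of 0 "int (Suc i)" \<alpha> x] r by (simp add: add_ac)
  next
    fix i assume "i < r" "E_mean (int i) x = 0"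
    then show "E_mean (int (Suc i)) x = 0"
      using hyperbolic_zero_Suc[OF hyperbolic_E_mean r nonneg] E_mean_0[of x] by simp
  qed (fact nonneg)
  then have minors: "minors_nonneg (binomial_conv \<alpha> s a)" by (rule minors_nonneg_conv[OF \<open>\<alpha> \<ge> 0\<close>])
  have a_eq: "a k = E_mean k x" if "k \<le> int s" for k
    using that by (auto simp: a_def E_mean_def r_def min_def split: if_splits)
  have a_ge: "E_mean k x \<le> a k" if "k \<le> int s + 1" for k
  proof (cases "k = int s + 1")
    case True
    then show ?thesis by (auto simp: a_def E_mean_def r_def nat_add_distrib add_ac split: if_splits)
  qed (use a_eq[of k] that in simp)
  have a0: "a k \<ge> 0" for k using nonneg[of "nat k"] by (auto simp: a_def)
  have S_eq: "S_mean \<alpha> k s x = binomial_conv \<alpha> s a k" if "k \<le> int s" for k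
    unfolding S_mean_conv binomial_conv_def using that by (intro sum.cong) (auto simp: a_eq)
  have S_le: "S_mean \<alpha> (j + 1) s x \<le> binomial_conv \<alpha> s a (j + 1)"
    unfolding S_mean_conv binomial_conv_def using j \<open>\<alpha> \<ge> 0\<close>
    by (intro sum_mono mult_left_mono a_ge) auto
  have "binomial_conv \<alpha> s a (j - 1) \<ge> 0"
    unfolding binomial_conv_def using a0 \<open>\<alpha> \<ge> 0\<close> by (intro sum_nonneg) auto
  then have "binomial_conv \<alpha> s a (j - 1) * S_mean \<alpha> (j + 1) s x
      \<le> binomial_conv \<alpha> s a (j - 1) * binomial_conv \<alpha> s a (j + 1)"
    using S_le by (rule mult_left_mono[rotated])
  also have "\<dots> \<le> binomial_conv \<alpha> s a j * binomial_conv \<alpha> s a j"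
    using minors by (simp add: minors_nonneg_def)
  finally show ?thesis using j by (simp add: S_eq power2_eq_square)
qed

section \<open>Maclaurin's root inequalities\<close>

lemma maclaurin_chain:
  fixes t :: "nat \<Rightarrow> real"
  assumes t0: "t 0 = 1" and nonneg: "\<And>i. i \<le> k \<Longrightarrow> t i \<ge> 0"
    and lc: "\<And>i. Suc i < k \<Longrightarrow> t i * t (Suc (Suc i)) \<le> (t (Suc i))\<^sup>2"
    and zero: "\<And>i. i < k \<Longrightarrow> t i = 0 \<Longrightarrow> t (Suc i) = 0"
    and j: "j \<ge> 1" "j < k"
  shows "root (j + 1) (t (j + 1)) \<le> root j (t j)"
proof -
  \<comment> \<open>The root inequality free of roots. In the induction, the hypothesis is combined
    with the \<open>Suc j\<close>-th power of \<open>lc\<close>, and \<open>t (Suc j) ^ j\<close>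
    cancels.\<close>
  have power: "t (Suc j) ^ j \<le> t j ^ Suc j" if "j < k" for j
    using that
  proof (induction j)
    case 0
    then show ?case by (simp add: t0)
  next
    case (Suc j)
    show ?case
    proof (cases "t (Suc j) = 0")
      case True
      then show ?thesis using zero[of "Suc j"] Suc.prems by simp
    next
      case False
      then have pos: "t (Suc j) > 0" using nonneg[of "Suc j"] Suc.prems by simp
      have nn: "t j \<ge> 0" "t (Suc (Suc j)) \<ge> 0" using nonneg Suc.prems by auto
      have "t (Suc j) ^ j * t (Suc (Suc j)) ^ Suc j \<le> t j ^ Suc j * t (Suc (Suc j)) ^ Suc j"
        using Suc nn by (intro mult_right_mono) auto
      also have "\<dots> = (t j * t (Suc (Suc j))) ^ Suc j" by (rule power_mult_distrib[symmetric])
      also have "\<dots> \<le> ((t (Suc j))\<^sup>2) ^ Suc j" using lc[of j] nn Suc.prems by (intro power_mono) auto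
      also have "\<dots> = t (Suc j) ^ j * t (Suc j) ^ Suc (Suc j)"
        by (simp add: power2_eq_square power_mult_distrib mult_ac)
      finally show ?thesis using pos by simp
    qed
  qed
  define u v where "u = root j (t j)" and "v = root (j + 1) (t (j + 1))"
  have uv: "u \<ge> 0" "u ^ j = t j" "v ^ (j + 1) = t (j + 1)"
    using j nonneg by (auto simp: u_def v_def real_root_pow_pos2 simp del: power_Suc)
  have "(v ^ (j + 1)) ^ j \<le> (u ^ j) ^ (j + 1)" using power[OF j(2)] unfolding uv by simp
  then have "v ^ ((j + 1) * j) \<le> u ^ ((j + 1) * j)" by (simp only: power_mult[symmetric] mult.commute)
  moreover have "(j + 1) * j = Suc ((j + 1) * j - 1)" using j by simp
  ultimately have "v \<le> u" using uv(1) power_le_imp_le_base by metis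
  then show ?thesis by (simp add: u_def v_def)
qed

lemma S_mean_root_chain:
  fixes x :: "real ^ 'n"
  assumes "\<alpha> \<ge> 0" and k: "k \<le> CARD('n)"
    and E: "\<And>i. i \<in> {1..s} \<Longrightarrow> E_mean (int i) x \<ge> 0"
    and S: "\<And>m. m \<in> {s + 1..k} \<Longrightarrow> S_mean \<alpha> (int m) s x \<ge> 0"
    and newton: "\<And>j. 1 \<le> j \<Longrightarrow> j \<le> int CARD('n) - 1 \<Longrightarrow>
      S_mean \<alpha> (j - 1) s x * S_mean \<alpha> (j + 1) s x \<le> (S_mean \<alpha> j s x)\<^sup>2"
    and j: "j \<ge> 1" "j < k"
  shows "root (j + 1) (S_mean \<alpha> (int (j + 1)) s x) \<le> root j (S_mean \<alpha> (int j) s x)"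
proof -
  have E': "E_mean i x \<ge> 0" if "i \<le> int s" for i
  proof -
    have "i < 0 \<or> i = 0 \<or> nat i \<in> {1..s} \<and> int (nat i) = i" using that by auto
    then show ?thesis using E[of "nat i"] E_mean_0[of x] by (auto simp: E_mean_def)
  qed
  have S0: "S_mean \<alpha> 0 s x = 1"
  proof -
    have "S_mean \<alpha> 0 s x = (\<Sum>i\<in>{0}. real (s choose i) * \<alpha> ^ i * E_mean (0 - int i) x)"
      unfolding S_mean_def by (rule sum.mono_neutral_right) (auto simp: E_mean_def)
    then show ?thesis by (simp add: E_mean_0)
  qed
  have nonneg: "S_mean \<alpha> (int m) s x \<ge> 0" if "m \<le> k" for m
  proof (cases "m \<le> s")
    case True
    then show ?thesis unfolding S_mean_def using \<open>\<alpha> \<ge> 0\<close> E' by (intro sum_nonneg) auto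
  qed (use S that in auto)
  have zero: "S_mean \<alpha> (int (Suc i)) s x = 0" if i: "i < k" "S_mean \<alpha> (int i) s x = 0" for i
  \<comment> \<open>For \<open>\<alpha> = 0\<close> these are the means themselves. Otherwise the
    term \<open>\<alpha> ^ m * E_mean 0 x\<close> makes the values up to index \<open>s\<close>
    positive, so a zero lies beyond \<open>s\<close>, in the real-rooted sequence starting at
    \<open>s\<close>.\<close>
  proof (cases "\<alpha> = 0")
    case True
    then show ?thesis
      using hyperbolic_zero_Suc[OF hyperbolic_E_mean k _ _ i(1), of x] nonneg i(2) E_mean_0[of x]
      by (simp add: S_mean_alpha_0)
  next
    case False
    have pos: "S_mean \<alpha> (int m) s x > 0" if "m \<le> s" for m
    proof -
      have "0 < real (s choose m) * \<alpha> ^ m * E_mean (int m - int m) x"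
        using False \<open>\<alpha> \<ge> 0\<close> that by (simp add: E_mean_0)
      also have "\<dots> \<le> S_mean \<alpha> (int m) s x"
        unfolding S_mean_def using that \<open>\<alpha> \<ge> 0\<close> E' by (intro member_le_sum) auto
      finally show ?thesis .
    qed
    then have "s < i" using i(2) by (metis less_irrefl not_le)
    then obtain i' where i': "i = s + i'" by (metis less_imp_add_positive)
    have "s \<le> CARD('n)" using \<open>s < i\<close> i k by simp
    note hyp = hyperbolic_S_mean[OF this, of \<alpha> x]
    have "S_mean \<alpha> (int (s + Suc i')) s x = 0"
      by (rule hyperbolic_zero_Suc[OF hyp, of "k - s"])
        (use nonneg pos[of s] i i' k \<open>s < i\<close> in \<open>auto simp del: of_nat_add\<close>)
    then show ?thesis by (simp add: i')
  qed
  show ?thesis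
  proof (rule maclaurin_chain[where t = "\<lambda>m. S_mean \<alpha> (int m) s x" and k = k])
    fix i assume "Suc i < k"
    then show "S_mean \<alpha> (int i) s x * S_mean \<alpha> (int (Suc (Suc i))) s x \<le> (S_mean \<alpha> (int (Suc i)) s x)\<^sup>2"
      using newton[of "int (Suc i)"] k by (simp add: add_ac)
  qed (use S0 nonneg zero j in auto)
qed

theorem theorem4:
  fixes s :: nat and \<alpha> :: real and x :: "real ^ 'n"
  assumes "s \<ge> 1"
  shows
    "(\<forall>k \<in> {int s + 1..int CARD('n) - 1}.
        (S_mean \<alpha> k s x)\<^sup>2 \<ge> S_mean \<alpha> (k - 1) s x * S_mean \<alpha> (k + 1) s x \<and>
        (\<not> ((\<forall>i j. x $ i = x $ j) \<or>
            ((S_mean \<alpha> k s x)\<^sup>2 = 0 \<and> S_mean \<alpha> (k - 1) s x * S_mean \<alpha> (k + 1) s x = 0) \<or>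
            (S_mean \<alpha> (k - 1) s x \<noteq> 0 \<and> S_mean \<alpha> k s x \<noteq> 0 \<and>
             S_mean \<alpha> k s x / S_mean \<alpha> (k - 1) s x = - \<alpha> \<and>
             S_mean \<alpha> (k + 1) s x / S_mean \<alpha> k s x = - \<alpha>)) \<longrightarrow>
         (S_mean \<alpha> k s x)\<^sup>2 > S_mean \<alpha> (k - 1) s x * S_mean \<alpha> (k + 1) s x)) \<and>
     (\<forall>k :: nat. k \<in> {2..CARD('n)} \<longrightarrow>
        \<alpha> \<ge> 0 \<longrightarrow>
        (\<forall>i \<in> {1..s}. E_mean (int i) x \<ge> 0) \<longrightarrow>
        (\<forall>m \<in> {s + 1..k}. S_mean \<alpha> (int m) s x \<ge> 0) \<longrightarrow>
        (\<forall>j \<in> {1..int CARD('n) - 1}.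
           (S_mean \<alpha> j s x)\<^sup>2 \<ge> S_mean \<alpha> (j - 1) s x * S_mean \<alpha> (j + 1) s x) \<and>
        (\<forall>j \<in> {1..<k}.
           root j (S_mean \<alpha> (int j) s x) \<ge> root (j + 1) (S_mean \<alpha> (int (j + 1)) s x)))"
proof (intro conjI ballI allI impI, goal_cases)
  case (1 k)
  then show ?case using S_mean_newton[of s k \<alpha> x] by simp
next
  case (2 k)
  then have k: "int s + 1 \<le> k" "k \<le> int CARD('n) - 1" by auto
  show ?case
  proof (rule ccontr)
    assume "\<not> ?case"
    with S_mean_newton[OF k, of \<alpha> x]
    have eq: "(S_mean \<alpha> k s x)\<^sup>2 = S_mean \<alpha> (k - 1) s x * S_mean \<alpha> (k + 1) s x" by simp
    with 2(2) have nz: "S_mean \<alpha> k s x \<noteq> 0" by auto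
    then have nz': "S_mean \<alpha> (k - 1) s x \<noteq> 0" using eq by auto
    \<comment> \<open>Under equality the two ratios coincide, so excluding the third alternative
      excludes the common value \<open>- \<alpha>\<close>.\<close>
    have "S_mean \<alpha> (k + 1) s x / S_mean \<alpha> k s x = S_mean \<alpha> k s x / S_mean \<alpha> (k - 1) s x"
      using eq nz nz' by (simp add: field_simps power2_eq_square)
    then have "S_mean \<alpha> k s x / S_mean \<alpha> (k - 1) s x \<noteq> - \<alpha>" using 2(2) nz nz' by auto
    from S_mean_newton_eq[OF k eq nz this] 2(2) show False by blast
  qed
next
  case (3 k j)
  show ?case
  proof (cases "j \<le> int s")
    case True
    with 3 show ?thesis using S_mean_newton_low[of \<alpha> s x j] by simp
  next
    case False
    with 3 show ?thesis using S_mean_newton[of s j \<alpha> x] by simp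
  qed
next
  case (4 k j)
  have "S_mean \<alpha> (j - 1) s x * S_mean \<alpha> (j + 1) s x \<le> (S_mean \<alpha> j s x)\<^sup>2"
    if "1 \<le> j" "j \<le> int CARD('n) - 1" for j
  proof (cases "j \<le> int s")
    case True
    with 4 that show ?thesis using S_mean_newton_low[of \<alpha> s x j] by simp
  next
    case False
    with that show ?thesis using S_mean_newton[of s j \<alpha> x] by simp
  qed
  then show ?case using 4 by (intro S_mean_root_chain) auto
qed

end
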